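(* Let $K_n$ be the complete graph with $n\ge 3$ vertices. Under the non-crossing criterion, the geometric pseudo-Grundy index of $K_n$ satisfies $$\gamma'_g(K_n)\le \frac{n^2}{4}+\Theta(n).$$
   Context: A geometric graph of a graph $G$ is a drawing of $G$ in the plane in which the vertices are points in general position (no three collinear) and every edge is the straight-line segment joining its endpoints. Two distinct edges cross if they meet at a point interior to both segments. Non-crossing criterion: two distinct edges are adjacent if and only if they do not cross (so edges sharing an endpoint are adjacent, and disjoint edges are adjacent). A pseudo-Grundy $k$-coloring of a geometric graph $\mathsf{G}$ is an assignment of the colors $1,\dots,k$ to all the edges (not necessarily proper), with every color used, such that for every pair of colors $i<j$, every edge of color $j$ is adjacent to at least one edge of color $i$. The pseudo-Grundy index $\gamma'(\mathsf{G})$ is the largest $k$ for which $\mathsf{G}$ has a pseudo-Grundy $k$-coloring. The geometric pseudo-Grundy index of a graph $G$ is $\gamma'_g(G)=\min\{\gamma'(\mathsf{G}) : \mathsf{G}\text{ is a geometric graph of } G\}$. The term $\Theta(n)$ in the upper bound denotes an error term that is linear in $n$: there is a constant $C>0$ such that $\gamma'_g(K_n)\le \frac{n^2}{4}+Cn$. *)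

theory Defs
  imports "HOL-Analysis.Analysis"
begin

type_synonym 'a ugraph = "'a set \<times> 'a set set"

abbreviation verts :: "'a ugraph \<Rightarrow> 'a set" where "verts \<equiv> fst"
abbreviation edges :: "'a ugraph \<Rightarrow> 'a set set" where "edges \<equiv> snd"

definition simple_graph :: "'a ugraph \<Rightarrow> bool" where
  "simple_graph G \<longleftrightarrow> finite (verts G) \<and> (\<forall>e\<in>edges G. e \<subseteq> verts G \<and> card e = 2)"

definition complete_graph :: "nat \<Rightarrow> nat ugraph" where
  "complete_graph n = ({..<n}, {e. e \<subseteq> {..<n} \<and> card e = 2})"

text \<open>Since edges are straight-line segments, a geometric graph of \<open>G\<close> is determined by the
  positions \<open>p\<close> of its vertices.\<close>

definition geometric_graph :: "'a ugraph \<Rightarrow> ('a \<Rightarrow> real^2) \<Rightarrow> bool" where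
  "geometric_graph G p \<longleftrightarrow> inj_on p (verts G) \<and>
     (\<forall>u\<in>verts G. \<forall>v\<in>verts G. \<forall>w\<in>verts G.
        u \<noteq> v \<and> v \<noteq> w \<and> u \<noteq> w \<longrightarrow> \<not> collinear {p u, p v, p w})"

text \<open>The interior of the segment that represents the edge \<open>e\<close>; the terms with \<open>u = v\<close>
  contribute nothing, because \<open>open_segment x x = {}\<close>.\<close>

definition edge_interior :: "('a \<Rightarrow> real^2) \<Rightarrow> 'a set \<Rightarrow> (real^2) set" where
  "edge_interior p e = (\<Union>u\<in>e. \<Union>v\<in>e. open_segment (p u) (p v))"

definition edges_cross :: "('a \<Rightarrow> real^2) \<Rightarrow> 'a set \<Rightarrow> 'a set \<Rightarrow> bool" where
  "edges_cross p e f \<longleftrightarrow> e \<noteq> f \<and> edge_interior p e \<inter> edge_interior p f \<noteq> {}"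

definition edges_adjacent :: "('a \<Rightarrow> real^2) \<Rightarrow> 'a set \<Rightarrow> 'a set \<Rightarrow> bool" where
  "edges_adjacent p e f \<longleftrightarrow> e \<noteq> f \<and> \<not> edges_cross p e f"

definition pseudo_grundy_coloring ::
    "'a ugraph \<Rightarrow> ('a \<Rightarrow> real^2) \<Rightarrow> nat \<Rightarrow> ('a set \<Rightarrow> nat) \<Rightarrow> bool" where
  "pseudo_grundy_coloring G p k c \<longleftrightarrow>
     c ` edges G = {1..k} \<and>
     (\<forall>i\<in>{1..k}. \<forall>j\<in>{1..k}. i < j \<longrightarrow>
        (\<forall>e\<in>edges G. c e = j \<longrightarrow> (\<exists>f\<in>edges G. c f = i \<and> edges_adjacent p e f)))"

definition pseudo_grundy_index :: "'a ugraph \<Rightarrow> ('a \<Rightarrow> real^2) \<Rightarrow> nat" where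
  "pseudo_grundy_index G p = Max {k. \<exists>c. pseudo_grundy_coloring G p k c}"

definition geometric_pseudo_grundy_index :: "'a ugraph \<Rightarrow> nat" where
  "geometric_pseudo_grundy_index G = Min (pseudo_grundy_index G ` {p. geometric_graph G p})"

text \<open>For finite simple graphs, the maximum and the minimum above are taken over finite
  nonempty sets.\<close>

lemma edge_interior_pair: "edge_interior p {u, v} = open_segment (p u) (p v)"
  by (auto simp: edge_interior_def open_segment_commute)

lemma simple_graph_complete_graph: "simple_graph (complete_graph n)"
  by (auto simp: simple_graph_def complete_graph_def)

lemma finite_edges:
  assumes "simple_graph G"
  shows "finite (edges G)"
proof (rule finite_subset)
  show "edges G \<subseteq> Pow (verts G)" "finite (Pow (verts G))"
    using assms by (auto simp: simple_graph_def)
qed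

lemma pseudo_grundy_coloring_le:
  assumes "simple_graph G" "pseudo_grundy_coloring G p k c"
  shows "k \<le> card (edges G)"
proof -
  have "k = card (c ` edges G)"
    using assms(2) by (simp add: pseudo_grundy_coloring_def)
  also have "\<dots> \<le> card (edges G)"
    using finite_edges[OF assms(1)] by (rule card_image_le)
  finally show ?thesis .
qed

lemma finite_pseudo_grundy_colorings:
  assumes "simple_graph G"
  shows "finite {k. \<exists>c. pseudo_grundy_coloring G p k c}"
  by (rule finite_subset[of _ "{..card (edges G)}"])
     (use pseudo_grundy_coloring_le[OF assms] in auto)

lemma pseudo_grundy_coloring_exists: "\<exists>k c. pseudo_grundy_coloring G p k c"
proof (cases "edges G = {}")
  case True
  then have "pseudo_grundy_coloring G p 0 (\<lambda>_. 1)"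
    by (simp add: pseudo_grundy_coloring_def)
  then show ?thesis by blast
next
  case False
  then have "pseudo_grundy_coloring G p 1 (\<lambda>_. 1)"
    by (auto simp: pseudo_grundy_coloring_def)
  then show ?thesis by blast
qed

lemma finite_pseudo_grundy_indices:
  assumes "simple_graph G"
  shows "finite (pseudo_grundy_index G ` {p. geometric_graph G p})"
proof (rule finite_subset)
  show "pseudo_grundy_index G ` {p. geometric_graph G p} \<subseteq> {..card (edges G)}"
  proof clarsimp
    fix p
    have "pseudo_grundy_index G p \<in> {k. \<exists>c. pseudo_grundy_coloring G p k c}"
      unfolding pseudo_grundy_index_def
      using finite_pseudo_grundy_colorings[OF assms] pseudo_grundy_coloring_exists[of G p]
      by (intro Max_in) auto
    then show "pseudo_grundy_index G p \<le> card (edges G)"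
      using pseudo_grundy_coloring_le[OF assms] by blast
  qed
qed simp

lemma parabola_not_collinear:
  fixes x y z :: real
  assumes "x \<noteq> y" "y \<noteq> z" "x \<noteq> z"
  shows "\<not> collinear {vector [x, x\<^sup>2], vector [y, y\<^sup>2], vector [z, z\<^sup>2] :: real^2}"
proof
  assume "collinear {vector [x, x\<^sup>2], vector [y, y\<^sup>2], vector [z, z\<^sup>2] :: real^2}"
  then obtain u where u: "\<forall>a\<in>{vector [x, x\<^sup>2], vector [y, y\<^sup>2], vector [z, z\<^sup>2] :: real^2}.
      \<forall>b\<in>{vector [x, x\<^sup>2], vector [y, y\<^sup>2], vector [z, z\<^sup>2]}. \<exists>c. a - b = c *\<^sub>R u"
    unfolding collinear_def by blast
  then obtain s t where
    s: "vector [x, x\<^sup>2] - (vector [y, y\<^sup>2] :: real^2) = s *\<^sub>R u" and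
    t: "vector [x, x\<^sup>2] - (vector [z, z\<^sup>2] :: real^2) = t *\<^sub>R u" by blast
  have "x - y = s * u$1" "x\<^sup>2 - y\<^sup>2 = s * u$2" "x - z = t * u$1" "x\<^sup>2 - z\<^sup>2 = t * u$2"
    using arg_cong[OF s, of "\<lambda>a. a$1"] arg_cong[OF s, of "\<lambda>a. a$2"]
      arg_cong[OF t, of "\<lambda>a. a$1"] arg_cong[OF t, of "\<lambda>a. a$2"] by simp_all
  then have "(x - y) * (x\<^sup>2 - z\<^sup>2) = (x - z) * (x\<^sup>2 - y\<^sup>2)" by simp
  then have "(x - y) * (x - z) * (z - y) = 0"
    by (simp add: power2_eq_square algebra_simps)
  then show False using assms by simp
qed

lemma geometric_graph_exists:
  assumes "simple_graph G"
  shows "\<exists>p. geometric_graph G p"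
proof -
  have "finite (verts G)"
    using assms by (simp add: simple_graph_def)
  then obtain g :: "'a \<Rightarrow> nat" where g: "inj_on g (verts G)"
    by (metis finite_imp_inj_to_nat_seg)
  define p :: "'a \<Rightarrow> real^2" where "p v = vector [real (g v), (real (g v))\<^sup>2]" for v
  have inj: "inj_on p (verts G)"
  proof (rule inj_onI)
    fix u v assume uv: "u \<in> verts G" "v \<in> verts G" "p u = p v"
    then have "p u $ 1 = p v $ 1" by simp
    then show "u = v" using uv g by (simp add: p_def inj_on_eq_iff)
  qed
  have "\<not> collinear {p u, p v, p w}"
    if "u \<in> verts G" "v \<in> verts G" "w \<in> verts G" "u \<noteq> v \<and> v \<noteq> w \<and> u \<noteq> w" for u v w
    unfolding p_def
    by (rule parabola_not_collinear) (use that g in \<open>simp_all add: inj_on_eq_iff\<close>)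
  with inj have "geometric_graph G p"
    unfolding geometric_graph_def by blast
  then show ?thesis by blast
qed

lemma edges_adjacent_common_vertex:
  assumes "geometric_graph G p" "u \<in> verts G" "v \<in> verts G" "w \<in> verts G"
    and "u \<noteq> v" "u \<noteq> w" "v \<noteq> w"
  shows "edges_adjacent p {u, v} {u, w}"
proof -
  have nc: "\<not> collinear {p u, p v, p w}"
    using assms by (auto simp: geometric_graph_def)
  have "open_segment (p u) (p v) \<inter> open_segment (p u) (p w) = {}"
  proof (rule ccontr)
    assume "open_segment (p u) (p v) \<inter> open_segment (p u) (p w) \<noteq> {}"
    then obtain x where x: "x \<in> open_segment (p u) (p v)" "x \<in> open_segment (p u) (p w)"
      by blast
    have "between (p u, p v) x" "between (p u, p w) x" and ne: "p u \<noteq> x"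
      using x by (auto simp: open_segment_def between_mem_segment)
    then have "collinear {p u, x, p v}" "collinear {p u, x, p w}"
      by (blast intro: between_imp_collinear)+
    moreover have "{p u, x, p v} = {p v, p u, x}" "{p v, p u, p w} = {p u, p v, p w}"
      by blast+
    ultimately have "collinear {p u, p v, p w}"
      using collinear_3_trans[of "p v" "p u" x "p w"] ne by metis
    with nc show False ..
  qed
  then show ?thesis
    using assms(5-7)
    by (auto simp: edges_adjacent_def edges_cross_def edge_interior_pair doubleton_eq_iff)
qed

end

theory Submission
  imports Defs
begin

text \<open>
  The bound comes from counting the colors that occur on one edge only. If two such edges
  \<open>e\<close> and \<open>f\<close> have colors \<open>i < j\<close>, then \<open>f\<close> has to be adjacent to some edge of color \<open>i\<close>, and
  the only candidate is \<open>e\<close>. So the edges that are alone in their color do not cross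
  each other. All remaining colors occur at least twice, which makes the number of colors at most
  half of the number of edges plus half of the size of a crossing-free set of edges
  (lemmas \<open>card_image_le_half_unique\<close> and \<open>uniquely_colored_edges_not_cross\<close>).

  Half of the number of edges is \<open>n (n - 1) / 4\<close>. The other summand is linear in \<open>n\<close> for any
  drawing, since a crossing-free set of edges is a plane graph. As the index is a minimum over
  drawings, it is enough to see this for one of them. On a parabola, chords with interleaved
  endpoints cross, and a set of pairs without interleaving has at most \<open>2 n\<close> members for a purely
  order-theoretic reason (lemmas \<open>parabola_chords_meet\<close> and \<open>card_non_interleaving_le\<close>).
\<close>

section \<open>Sets of pairs without interleaving\<close>

lemma card_2_eq_Min_Max:
  fixes e :: "'a::linorder set"
  assumes "card e = 2"
  shows "e = {Min e, Max e}" and "Min e < Max e"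
proof -
  obtain x y where e: "e = {x, y}" "x \<noteq> y"
    using assms by (auto simp: card_2_iff)
  have "e = {Min e, Max e} \<and> Min e < Max e"
    using e by (cases "x < y") (auto simp: min_def max_def)
  then show "e = {Min e, Max e}" and "Min e < Max e"
    by blast+
qed

text \<open>
  Think of a pair as an arc above the line. If \<open>{a, b}\<close> is neither the longest arc starting in
  its left end \<open>a\<close> nor the longest arc ending in its right end \<open>b\<close>, then a longer arc
  \<open>{a, b'}\<close> and a longer arc \<open>{a', b}\<close> interleave as \<open>a' < a < b < b'\<close>. So every arc is longest
  at one of its ends, and each point is the left end of at most one longest arc and the right
  end of at most one.
\<close>

lemma card_non_interleaving_le:
  fixes V :: "'a::linorder set"
  assumes "finite V" and S: "\<And>e. e \<in> S \<Longrightarrow> e \<subseteq> V \<and> card e = 2"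
    and non_interleaving: "\<And>a b c d. \<lbrakk>a < c; c < b; b < d; {a, b} \<in> S\<rbrakk> \<Longrightarrow> {c, d} \<notin> S"
  shows "card S \<le> 2 * card V"
proof -
  define R where "R = {e \<in> S. \<forall>f\<in>S. Min f = Min e \<longrightarrow> Max f \<le> Max e}"
  define L where "L = {e \<in> S. \<forall>f\<in>S. Max f = Max e \<longrightarrow> Min e \<le> Min f}"
  have pair: "e = {Min e, Max e}" "Min e < Max e" if "e \<in> S" for e
    using card_2_eq_Min_Max S that by blast+
  have in_V: "Min e \<in> V" "Max e \<in> V" if "e \<in> S" for e
    using pair(1)[OF that] S[OF that] by blast+
  have "e \<in> R \<union> L" if "e \<in> S" for e
  proof (rule ccontr)
    assume "e \<notin> R \<union> L"
    then obtain f g where f: "f \<in> S" "Min f = Min e" "Max e < Max f"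
      and g: "g \<in> S" "Max g = Max e" "Min g < Min e"
      using \<open>e \<in> S\<close> by (auto simp: R_def L_def not_le)
    have "{Min e, Max f} \<in> S" "{Min g, Max e} \<in> S"
      using pair(1) f g by metis+
    then show False
      using non_interleaving g(3) pair(2)[OF \<open>e \<in> S\<close>] f(3) by blast
  qed
  then have "S = R \<union> L"
    by (auto simp: R_def L_def)
  moreover have "card R \<le> card V"
  proof (rule card_inj_on_le)
    show "inj_on Min R"
    proof (rule inj_onI)
      fix e f assume ef: "e \<in> R" "f \<in> R" "Min e = Min f"
      then have "Max e = Max f"
        by (auto simp: R_def intro: antisym)
      then show "e = f"
        using ef pair(1)[of e] pair(1)[of f] by (simp add: R_def)
    qed
  qed (use in_V \<open>finite V\<close> in \<open>auto simp: R_def\<close>)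
  moreover have "card L \<le> card V"
  proof (rule card_inj_on_le)
    show "inj_on Max L"
    proof (rule inj_onI)
      fix e f assume ef: "e \<in> L" "f \<in> L" "Max e = Max f"
      then have "Min e = Min f"
        by (auto simp: L_def intro: antisym)
      then show "e = f"
        using ef pair(1)[of e] pair(1)[of f] by (simp add: L_def)
    qed
  qed (use in_V \<open>finite V\<close> in \<open>auto simp: L_def\<close>)
  ultimately show ?thesis
    using card_Un_le[of R L] by simp
qed

section \<open>Colors that occur only once\<close>

text \<open>
  Remove one representative per value of \<open>c\<close> from \<open>E\<close>. The rest has \<open>card E - card (c ` E)\<close>
  elements, and it still attains each value except those attained only once.
\<close>

lemma card_image_le_half_unique:
  assumes "finite E"
  shows "2 * card (c ` E) \<le> card E + card {e \<in> E. \<forall>f\<in>E. c f = c e \<longrightarrow> f = e}"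
proof -
  define U where "U = {e \<in> E. \<forall>f\<in>E. c f = c e \<longrightarrow> f = e}"
  define R where "R = inv_into E c ` c ` E"
  have R: "R \<subseteq> E"
    by (auto simp: R_def inv_into_into)
  have card_R: "card R = card (c ` E)"
    unfolding R_def by (rule card_image) (rule inj_on_inv_into, simp)
  have "c ` E \<subseteq> c ` U \<union> c ` (E - R)"
  proof
    fix i assume "i \<in> c ` E"
    define r where "r = inv_into E c i"
    have r: "r \<in> E" "c r = i"
      using \<open>i \<in> c ` E\<close> by (simp_all add: r_def inv_into_into f_inv_into_f)
    have unique_in_R: "f = r" if "f \<in> R" "c f = i" for f
      using that by (auto simp: R_def r_def f_inv_into_f)
    show "i \<in> c ` U \<union> c ` (E - R)"
    proof (cases "r \<in> U")
      case False
      then obtain f where "f \<in> E" "c f = i" "f \<noteq> r"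
        using r by (auto simp: U_def)
      then have "f \<in> E - R"
        using unique_in_R by blast
      then show ?thesis
        using \<open>c f = i\<close> by blast
    qed (use r in blast)
  qed
  moreover have "finite U"
    using assms by (simp add: U_def)
  ultimately have "card (c ` E) \<le> card (c ` U) + card (c ` (E - R))"
    using assms by (meson card_Un_le card_mono finite_Diff finite_Un finite_imageI le_trans)
  also have "\<dots> \<le> card U + card (E - R)"
    using \<open>finite U\<close> assms by (intro add_mono card_image_le) auto
  also have "card (E - R) = card E - card (c ` E)"
    using R assms by (simp add: card_Diff_subset finite_subset card_R)
  finally have "card (c ` E) \<le> card U + (card E - card (c ` E))" .
  moreover have "card (c ` E) \<le> card E"
    using assms by (rule card_image_le)
  ultimately show ?thesis
    unfolding U_def by linarith
qed

lemma edges_cross_commute: "edges_cross p e f \<longleftrightarrow> edges_cross p f e"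
  by (auto simp: edges_cross_def)

lemma uniquely_colored_edges_not_cross:
  assumes col: "pseudo_grundy_coloring G p k c"
    and "e \<in> edges G" and e: "\<And>g. \<lbrakk>g \<in> edges G; c g = c e\<rbrakk> \<Longrightarrow> g = e"
    and "f \<in> edges G" and f: "\<And>g. \<lbrakk>g \<in> edges G; c g = c f\<rbrakk> \<Longrightarrow> g = f"
  shows "\<not> edges_cross p e f"
proof (cases "e = f")
  case True
  then show ?thesis
    by (simp add: edges_cross_def)
next
  case False
  have *: "\<not> edges_cross p y x"
    if xy: "x \<in> edges G" "y \<in> edges G" "c x < c y"
      and x: "\<And>g. \<lbrakk>g \<in> edges G; c g = c x\<rbrakk> \<Longrightarrow> g = x" for x y
  proof -
    have "c x \<in> {1..k}" "c y \<in> {1..k}"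
      using col xy(1,2) by (auto simp: pseudo_grundy_coloring_def)
    then obtain g where "g \<in> edges G" "c g = c x" "edges_adjacent p y g"
      using col xy(2,3) unfolding pseudo_grundy_coloring_def by blast
    then show ?thesis
      using x by (auto simp: edges_adjacent_def)
  qed
  have "c e < c f \<or> c f < c e"
    using False e[OF \<open>f \<in> edges G\<close>] by fastforce
  then show ?thesis
    using *[OF assms(2,4) _ e] *[OF assms(4,2) _ f] edges_cross_commute[of p e f] by blast
qed

section \<open>The two indices as extrema\<close>

lemma pseudo_grundy_index_attained:
  assumes "simple_graph G"
  shows "\<exists>c. pseudo_grundy_coloring G p (pseudo_grundy_index G p) c"
proof -
  have "pseudo_grundy_index G p \<in> {k. \<exists>c. pseudo_grundy_coloring G p k c}"
    unfolding pseudo_grundy_index_def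
    using finite_pseudo_grundy_colorings[OF assms] pseudo_grundy_coloring_exists[of G p]
    by (intro Max_in) auto
  then show ?thesis
    by simp
qed

lemma geometric_pseudo_grundy_index_le:
  assumes "simple_graph G" "geometric_graph G p"
  shows "geometric_pseudo_grundy_index G \<le> pseudo_grundy_index G p"
  unfolding geometric_pseudo_grundy_index_def
  using assms(2) by (intro Min_le finite_pseudo_grundy_indices[OF assms(1)] imageI) simp

section \<open>The drawing on a parabola\<close>

definition parabola_point :: "real \<Rightarrow> real^2" where
  "parabola_point x = vector [x, x\<^sup>2]"

lemma parabola_chord_point:
  assumes "a < x" "x < b"
  shows "vector [x, (a + b) * x - a * b] \<in> open_segment (parabola_point a) (parabola_point b)"
proof -
  define u where "u = (x - a) / (b - a)"
  have "0 < u" "u < 1"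
    using assms by (auto simp: u_def field_simps)
  have x: "x = a + u * (b - a)"
    using assms by (simp add: u_def)
  have "vector [x, (a + b) * x - a * b] =
      (1 - u) *\<^sub>R parabola_point a + u *\<^sub>R parabola_point b"
    unfolding vec_eq_iff forall_2 x
    by (simp add: parabola_point_def power2_eq_square algebra_simps)
  moreover have "parabola_point a \<noteq> parabola_point b"
    using assms by (auto simp: parabola_point_def vec_eq_iff forall_2)
  ultimately show ?thesis
    using \<open>0 < u\<close> \<open>u < 1\<close> by (auto simp: in_segment)
qed

lemma parabola_chords_meet:
  assumes "a < c" "c < b" "b < d"
  shows "open_segment (parabola_point a) (parabola_point b) \<inter>
    open_segment (parabola_point c) (parabola_point d) \<noteq> {}"
proof -
  \<comment> \<open>The abscissa at which the lines \<open>y = (a + b) x - a b\<close> and \<open>y = (c + d) x - c d\<close> meet.\<close>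
  define x where "x = (c * d - a * b) / (c + d - a - b)"
  have pos: "c + d - a - b > 0"
    using assms by simp
  have "x - c = (c - a) * (b - c) / (c + d - a - b)"
    "b - x = (b - c) * (d - b) / (c + d - a - b)"
    using pos by (simp_all add: x_def field_simps)
  moreover have "(c - a) * (b - c) / (c + d - a - b) > 0"
    "(b - c) * (d - b) / (c + d - a - b) > 0"
    using assms pos by simp_all
  ultimately have "c < x" "x < b"
    by linarith+
  have "(c + d - a - b) * x = c * d - a * b"
    using pos by (simp add: x_def)
  then have "(a + b) * x - a * b = (c + d) * x - c * d"
    by (simp add: algebra_simps)
  then show ?thesis
    using parabola_chord_point[of a x b] parabola_chord_point[of c x d]
      assms \<open>c < x\<close> \<open>x < b\<close> by auto
qed

lemma geometric_graph_parabola: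
  fixes G :: "nat ugraph"
  shows "geometric_graph G (\<lambda>i. parabola_point (real i))"
proof -
  have "inj_on (\<lambda>i::nat. parabola_point (real i)) (verts G)"
    by (auto simp: inj_on_def parabola_point_def vec_eq_iff forall_2)
  then show ?thesis
    using parabola_not_collinear by (auto simp: geometric_graph_def parabola_point_def)
qed

section \<open>The upper bound\<close>

theorem theorem11:
  shows "\<exists>C>0. \<forall>n\<ge>3.
    real (geometric_pseudo_grundy_index (complete_graph n)) \<le> (real n)\<^sup>2 / 4 + C * real n"
proof -
  have "real (geometric_pseudo_grundy_index (complete_graph n)) \<le> (real n)\<^sup>2 / 4 + 1 * real n"
    for n :: nat
  proof -
    define p where "p i = parabola_point (real i)" for i :: nat
    define k where "k = pseudo_grundy_index (complete_graph n) p"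
    define E where "E = edges (complete_graph n)"
    obtain c where col: "pseudo_grundy_coloring (complete_graph n) p k c"
      unfolding k_def using pseudo_grundy_index_attained[OF simple_graph_complete_graph] by blast
    define U where "U = {e \<in> E. \<forall>f\<in>E. c f = c e \<longrightarrow> f = e}"
    have E: "E = {e. e \<subseteq> {..<n} \<and> card e = 2}"
      by (simp add: E_def complete_graph_def)
    have "card U \<le> 2 * card {..<n}"
    proof (rule card_non_interleaving_le)
      fix i j l m :: nat
      assume order: "i < l" "l < j" "j < m" and ij: "{i, j} \<in> U"
      have "edges_cross p {i, j} {l, m}"
        using order parabola_chords_meet[of "real i" "real l" "real j" "real m"]
        by (auto simp: edges_cross_def edge_interior_pair p_def doubleton_eq_iff)
      then show "{l, m} \<notin> U"
        using uniquely_colored_edges_not_cross[OF col, of "{i, j}" "{l, m}"] ij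
        unfolding U_def E_def by blast
    qed (auto simp: U_def E)
    moreover have "2 * card (c ` E) \<le> card E + card U"
      unfolding U_def
      by (rule card_image_le_half_unique) (simp add: E_def finite_edges simple_graph_complete_graph)
    moreover have "card (c ` E) = k"
      using col by (simp add: pseudo_grundy_coloring_def E_def)
    ultimately have "2 * k \<le> card E + 2 * n"
      by simp
    then have k: "2 * real k \<le> real (card E) + 2 * real n"
      by linarith
    have "card E = n * (n - 1) div 2"
      by (simp add: E n_subsets choose_two)
    then have "2 * card E \<le> n * (n - 1)"
      by simp
    then have "real (card E) \<le> real (n * (n - 1)) / 2"
      by linarith
    also have "\<dots> \<le> (real n)\<^sup>2 / 2"
      by (simp add: power2_eq_square mult_left_mono)
    finally have "real k \<le> (real n)\<^sup>2 / 4 + real n"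
      using k by simp
    moreover have "geometric_pseudo_grundy_index (complete_graph n) \<le> k"
      unfolding k_def p_def
      by (rule geometric_pseudo_grundy_index_le[OF simple_graph_complete_graph
            geometric_graph_parabola])
    ultimately show ?thesis
      by linarith
  qed
  then show ?thesis
    using zero_less_one by blast
qed

end
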